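(* Let $G$ be a finite simple graph, $\Lambda\subseteq\Omega(G)$, $|\Lambda|\ge 1$. (i) If $\bigcup\Lambda$ is critical, then $\left|N\left(\bigcap\Lambda\right)\right|+\left|\bigcup\Lambda\right|=|V(G)|$, and $\bigcap\Lambda$ is critical. (ii) If $\bigcap\Lambda$ is critical, then $\left|N\left(\bigcap\Lambda\right)\right|+\left|\bigcup\Lambda\right|\le |V(G)|$ and $d\left(\bigcap\Lambda\right)\ge 2\alpha(G)-|V(G)|$.
   Context: For $X\subseteq V(G)$, $N(X)$ is the set of vertices adjacent to some vertex of $X$, $d(X)=|X|-|N(X)|$, $d(G)=\max\{d(X):X\subseteq V(G)\}$, and $X$ is critical if $d(X)=d(G)$. $\alpha(G)$ is the maximum cardinality of an independent set and $\Omega(G)$ is the family of all maximum independent sets. $\bigcup\Lambda,\bigcap\Lambda$ denote union and intersection of the members of $\Lambda$. *)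

theory Defs
  imports "Graph_Theory.Digraph"
begin

text \<open>
  The locale \<^locale>\<open>graph\<close> represents a finite simple graph as a finite loop-free symmetric
  digraph without parallel arcs: an undirected edge \<open>uv\<close> is the pair of arcs \<open>u \<rightarrow> v\<close>, \<open>v \<rightarrow> u\<close>.
\<close>

definition nbhd :: "('a, 'b) pre_digraph \<Rightarrow> 'a set \<Rightarrow> 'a set" where
  "nbhd G X = {v \<in> verts G. \<exists>x\<in>X. x \<rightarrow>\<^bsub>G\<^esub> v}"

definition set_diff :: "('a, 'b) pre_digraph \<Rightarrow> 'a set \<Rightarrow> int" where
  "set_diff G X = int (card X) - int (card (nbhd G X))"

definition graph_diff :: "('a, 'b) pre_digraph \<Rightarrow> int" where
  "graph_diff G = Max {set_diff G X | X. X \<subseteq> verts G}"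

definition critical :: "('a, 'b) pre_digraph \<Rightarrow> 'a set \<Rightarrow> bool" where
  "critical G X \<longleftrightarrow> X \<subseteq> verts G \<and> set_diff G X = graph_diff G"

definition independent_set :: "('a, 'b) pre_digraph \<Rightarrow> 'a set \<Rightarrow> bool" where
  "independent_set G S \<longleftrightarrow> S \<subseteq> verts G \<and> (\<forall>u\<in>S. \<forall>v\<in>S. \<not> u \<rightarrow>\<^bsub>G\<^esub> v)"

definition indep_number :: "('a, 'b) pre_digraph \<Rightarrow> nat" where
  "indep_number G = Max {card S | S. independent_set G S}"

definition max_indep_sets :: "('a, 'b) pre_digraph \<Rightarrow> 'a set set" where
  "max_indep_sets G = {S. independent_set G S \<and> card S = indep_number G}"

end

theory Submission
  imports Defs
begin

text \<open>
  Write \<open>U = \<Union>\<Lambda>\<close> and \<open>I = \<Inter>\<Lambda>\<close>. No vertex of \<open>U\<close> has a neighbour in \<open>I\<close>, so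
  \<open>|N(I)| \<le> |V| - |U|\<close>. A vertex without neighbours in \<open>U\<close> lies in every member of \<open>\<Lambda>\<close> by
  maximality, so \<open>N(U) = V - I\<close>. Hence \<open>d(I) \<ge> |I| + |U| - |V| = d(U)\<close>, and if \<open>U\<close> is critical
  then equality holds throughout. For (ii), compare \<open>I\<close> with a single member \<open>S\<close> of \<open>\<Lambda>\<close>, for which
  \<open>d(S) \<ge> |S| - (|V| - |S|)\<close>.
\<close>

lemma set_diff_le_graph_diff:
  assumes "finite (verts G)" and "X \<subseteq> verts G"
  shows "set_diff G X \<le> graph_diff G"
proof -
  have "finite {set_diff G X | X. X \<subseteq> verts G}"
    using assms(1) by simp
  then show ?thesis
    unfolding graph_diff_def using assms(2) by (intro Max_ge) auto
qed

lemma card_le_indep_number: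
  assumes "finite (verts G)" and "independent_set G S"
  shows "card S \<le> indep_number G"
proof -
  have "{card S | S. independent_set G S} \<subseteq> card ` Pow (verts G)"
    by (auto simp: independent_set_def)
  then have "finite {card S | S. independent_set G S}"
    using assms(1) by (meson finite_Pow_iff finite_imageI finite_subset)
  then show ?thesis
    unfolding indep_number_def using assms(2) by (intro Max_ge) auto
qed

context graph
begin

text \<open>Otherwise \<open>insert v S\<close> would be independent and larger than
  \<open>S\<close>.\<close>

lemma max_indep_set_dominating:
  assumes S: "S \<in> max_indep_sets G" and v: "v \<in> verts G" and nonadj: "v \<notin> nbhd G S"
  shows "v \<in> S"
proof (rule ccontr)
  assume "v \<notin> S"
  have ind: "independent_set G S" and card: "card S = indep_number G"
    using S by (auto simp: max_indep_sets_def)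
  \<comment> \<open>\<open>nbhd\<close> only excludes arcs from \<open>S\<close> to
    \<open>v\<close>; symmetry excludes the reverse ones.\<close>
  have "\<forall>x\<in>S. \<not> x \<rightarrow>\<^bsub>G\<^esub> v \<and> \<not> v \<rightarrow>\<^bsub>G\<^esub> x"
    using nonadj v arcs_ends_symmetric[OF sym_arcs] by (auto simp: nbhd_def)
  then have "independent_set G (insert v S)"
    using ind v by (auto simp: independent_set_def dest: adj_not_same)
  then have "card (insert v S) \<le> card S"
    using card_le_indep_number[of G] card by simp
  moreover have "finite S"
    using ind finite_subset[OF _ finite_verts] by (auto simp: independent_set_def)
  ultimately show False
    using \<open>v \<notin> S\<close> by simp
qed

text \<open>A vertex of the intersection lies in every member \<open>S\<close>, so a neighbour of it
  inside \<open>S\<close> would contradict the independence of \<open>S\<close>.\<close>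

lemma nbhd_Inter_disjoint_Union:
  assumes "\<forall>S\<in>\<Lambda>. independent_set G S"
  shows "nbhd G (\<Inter>\<Lambda>) \<inter> \<Union>\<Lambda> = {}"
  using assms by (fastforce simp: nbhd_def independent_set_def)

lemma nbhd_Union_max_indep_sets:
  assumes "\<Lambda> \<subseteq> max_indep_sets G"
  shows "nbhd G (\<Union>\<Lambda>) = verts G - \<Inter>\<Lambda>"
proof
  show "nbhd G (\<Union>\<Lambda>) \<subseteq> verts G - \<Inter>\<Lambda>"
    using assms by (fastforce simp: nbhd_def max_indep_sets_def independent_set_def)
  show "verts G - \<Inter>\<Lambda> \<subseteq> nbhd G (\<Union>\<Lambda>)"
    using assms max_indep_set_dominating by (fastforce simp: nbhd_def)
qed

lemma card_nbhd_Inter_add_card_Union_le: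
  assumes "\<forall>S\<in>\<Lambda>. independent_set G S"
  shows "card (nbhd G (\<Inter>\<Lambda>)) + card (\<Union>\<Lambda>) \<le> card (verts G)"
proof -
  have sub: "nbhd G (\<Inter>\<Lambda>) \<subseteq> verts G" "\<Union>\<Lambda> \<subseteq> verts G"
    using assms by (auto simp: nbhd_def independent_set_def)
  then have "card (nbhd G (\<Inter>\<Lambda>)) + card (\<Union>\<Lambda>) = card (nbhd G (\<Inter>\<Lambda>) \<union> \<Union>\<Lambda>)"
    using nbhd_Inter_disjoint_Union[OF assms] finite_verts
    by (metis card_Un_disjoint finite_subset)
  also have "\<dots> \<le> card (verts G)"
    using sub by (intro card_mono) auto
  finally show ?thesis .
qed

lemma graph_diff_ge: "graph_diff G \<ge> 2 * int (card S) - int (card (verts G))"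
  if "independent_set G S"
proof -
  have "card (nbhd G S) + card S \<le> card (verts G)"
    \<comment> \<open>For the family \<open>{S}\<close>, union and intersection are both
      \<open>S\<close>.\<close>
    using card_nbhd_Inter_add_card_Union_le[of "{S}"] that by simp
  moreover have "set_diff G S \<le> graph_diff G"
    using that by (intro set_diff_le_graph_diff) (auto simp: independent_set_def)
  ultimately show ?thesis
    by (simp add: set_diff_def)
qed

end

theorem theorem3p3:
  fixes G :: "('a, 'b) pre_digraph" and \<Lambda> :: "'a set set"
  assumes "graph G"
    and "\<Lambda> \<subseteq> max_indep_sets G"
    and "card \<Lambda> \<ge> 1"
  shows "(critical G (\<Union>\<Lambda>) \<longrightarrow>
            card (nbhd G (\<Inter>\<Lambda>)) + card (\<Union>\<Lambda>) = card (verts G) \<and> critical G (\<Inter>\<Lambda>)) \<and>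
         (critical G (\<Inter>\<Lambda>) \<longrightarrow>
            card (nbhd G (\<Inter>\<Lambda>)) + card (\<Union>\<Lambda>) \<le> card (verts G) \<and>
            set_diff G (\<Inter>\<Lambda>) \<ge> 2 * int (indep_number G) - int (card (verts G)))"
proof -
  interpret graph G by fact
  have ind: "\<forall>S\<in>\<Lambda>. independent_set G S"
    using assms(2) by (auto simp: max_indep_sets_def)
  \<comment> \<open>A member is needed to bound \<open>\<Inter>\<Lambda>\<close>: the empty family
    would have intersection \<open>UNIV\<close>.\<close>
  obtain S where S: "S \<in> \<Lambda>"
    using assms(3) by fastforce
  have Int_sub: "\<Inter>\<Lambda> \<subseteq> verts G"
    using S ind by (auto simp: independent_set_def)
  note le = card_nbhd_Inter_add_card_Union_le[OF ind]
  have "card (nbhd G (\<Union>\<Lambda>)) + card (\<Inter>\<Lambda>) = card (verts G)"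
    using nbhd_Union_max_indep_sets[OF assms(2)] Int_sub
    by (simp add: card_Diff_subset card_mono finite_subset[OF Int_sub])
  moreover have "set_diff G (\<Inter>\<Lambda>) \<le> graph_diff G"
    using Int_sub by (intro set_diff_le_graph_diff) auto
  \<comment> \<open>In the chain d(U) = |U| + |I| - |V| \<le> d(I) \<le> d(G), criticality of U
    makes the ends equal; equality in the first inequality is the cardinality identity, in the
    second the criticality of I.\<close>
  ultimately have "critical G (\<Union>\<Lambda>) \<longrightarrow>
      card (nbhd G (\<Inter>\<Lambda>)) + card (\<Union>\<Lambda>) = card (verts G) \<and> critical G (\<Inter>\<Lambda>)"
    using le Int_sub by (auto simp: critical_def set_diff_def)
  moreover have "graph_diff G \<ge> 2 * int (indep_number G) - int (card (verts G))"
    using graph_diff_ge[of S] S assms(2) by (auto simp: max_indep_sets_def)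
  ultimately show ?thesis
    using le by (auto simp: critical_def)
qed

end
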